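(* Let $G$ be a group and let $H$ be a finitely generated subgroup of $G$. If the universe problem for $G$-automata is decidable, then the subgroup membership problem for $H$ in $G$ is decidable.
   Context: A $G$-automaton is a 6-tuple $V=(Q,\Sigma,G,\delta,q_0,Q_a)$ where $Q$ is a finite set of states, $\Sigma$ is a finite input alphabet, $q_0\in Q$ is the initial state, $Q_a\subseteq Q$ is the set of accepting states, and $\delta$ assigns to each pair in $Q\times(\Sigma\cup\{\varepsilon\})$ ($\varepsilon$ the empty string) a finite subset of $Q\times G$. If $(q',m)\in\delta(q,\sigma)$, then in state $q$, reading $\sigma$ (consuming no input if $\sigma=\varepsilon$), $V$ may move to state $q'$ and replace its register content $x\in G$ by $xm$. The register initially contains the identity element $1$ of $G$. A string $w\in\Sigma^*$ is accepted if some computation starting in $q_0$ reads all of $w$ and ends in a state of $Q_a$ with register content equal to $1$. $L(V)\subseteq\Sigma^*$ denotes the set of accepted strings. The universe problem for $G$-automata: given a $G$-automaton $V$ with input alphabet $\Sigma$, decide whether $L(V)=\Sigma^*$, i.e. whether $V$ accepts every string. The subgroup membership problem for $H$ in $G$: given an element $g\in G$, decide whether $g\in H$, where $H$ is the subgroup of $G$ generated by given elements $h_1,\dots,h_n\in G$. Elements of $G$ occurring in inputs (as transition labels of automata, or as the element $g$) are given in one fixed encoding of the elements of $G$ by finite strings (for example, as words over a finite generating set and its inverses when $G$ is finitely generated), where every element of $G$ has at least one code. *)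

theory Defs
  imports "HOL-Algebra.Generated_Groups" "HOL-Library.Nat_Bijection"
begin

section \<open>Partial recursive functions and decidable problems\<close>

datatype recf =
  Zero | Succ | Proj nat | Comp recf "recf list" | PrimRec recf recf | Mu recf

text \<open>\<open>computes f xs y\<close>: on arguments \<open>xs\<close> the function described by \<open>f\<close> is defined, with
  value \<open>y\<close>. There is no separate arity check: a description applied to the wrong number of
  arguments either has no value or ignores the surplus ones. The recursion variable of
  \<open>PrimRec\<close> and the search variable of \<open>Mu\<close> come first.\<close>

inductive computes :: "recf \<Rightarrow> nat list \<Rightarrow> nat \<Rightarrow> bool" where
  Zero: "computes Zero xs 0"
| Succ: "computes Succ [x] (Suc x)"
| Proj: "i < length xs \<Longrightarrow> computes (Proj i) xs (xs ! i)"
| Comp: "list_all2 (\<lambda>g z. computes g xs z) gs zs \<Longrightarrow> computes f zs y \<Longrightarrow>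
    computes (Comp f gs) xs y"
| PrimRec_0: "computes f xs y \<Longrightarrow> computes (PrimRec f g) (0 # xs) y"
| PrimRec_Suc: "computes (PrimRec f g) (n # xs) r \<Longrightarrow> computes g (n # r # xs) y \<Longrightarrow>
    computes (PrimRec f g) (Suc n # xs) y"
| Mu: "computes f (n # xs) 0 \<Longrightarrow> (\<forall>m<n. \<exists>y>0. computes f (m # xs) y) \<Longrightarrow>
    computes (Mu f) xs n"

lemma computes_unique: "computes f xs y \<Longrightarrow> computes f xs z \<Longrightarrow> y = z"
proof (induction arbitrary: z rule: computes.induct)
  case (Comp xs gs zs f y)
  from Comp.prems obtain zs' where
    zs': "list_all2 (\<lambda>g z. computes g xs z) gs zs'" "computes f zs' z"
    by (cases rule: computes.cases) auto
  have "zs = zs'"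
    using Comp.IH(1) zs'(1) by (auto simp: list_all2_conv_all_nth intro!: nth_equalityI)
  then show ?case using Comp.IH(2) zs'(2) by blast
next
  case (PrimRec_Suc f g n xs r y)
  from PrimRec_Suc.prems obtain r' where
    "computes (PrimRec f g) (n # xs) r'" "computes g (n # r' # xs) z"
    by (cases rule: computes.cases) auto
  then show ?case using PrimRec_Suc.IH by blast
next
  case (Mu f n xs)
  from Mu.prems have z: "computes f (z # xs) 0 \<and> (\<forall>m<z. \<exists>y>0. computes f (m # xs) y)"
    by (cases rule: computes.cases) auto
  show ?case
  proof (rule linorder_cases[of n z])
    assume "n < z"
    then obtain y where "y > 0" "computes f (n # xs) y" using z by blast
    then show ?thesis using Mu.IH(1) by fastforce
  next
    assume "z < n"
    then obtain y where "y > 0" "\<And>v. computes f (z # xs) v \<longrightarrow> y = v"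
      using Mu.IH(2) by blast
    then show ?thesis using z by fastforce
  qed
next
  case (PrimRec_0 f xs y g)
  from PrimRec_0.prems have "computes f xs z" by (cases rule: computes.cases) auto
  then show ?case using PrimRec_0.IH by blast
qed (erule computes.cases; simp)+

text \<open>Decidability of the yes/no question \<open>P\<close> about instances that are presented by numerical
  codes: \<open>codes x i\<close> means that \<open>x\<close> is a code of the instance \<open>i\<close>. An instance may have many
  codes. The algorithm has to halt with the right answer on every code of every instance; nothing
  is required of it on numbers that code no instance.\<close>

definition decidable :: "(nat \<Rightarrow> 'i \<Rightarrow> bool) \<Rightarrow> ('i \<Rightarrow> bool) \<Rightarrow> bool" where
  "decidable codes P \<longleftrightarrow>
    (\<exists>f. \<forall>x i. codes x i \<longrightarrow> computes f [x] (if P i then 1 else 0))"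


section \<open>Automata with a group register\<close>

text \<open>In \<open>delta\<close>, the letter \<open>None\<close> stands for the empty string.\<close>

record ('q, 's, 'a) automaton =
  states :: "'q set"
  input_alphabet :: "'s set"
  delta :: "'q \<Rightarrow> 's option \<Rightarrow> ('q \<times> 'a) set"
  initial :: 'q
  accepting :: "'q set"

definition labels :: "('q, 's, 'a) automaton \<Rightarrow> 's option set" where
  "labels V = insert None (Some ` input_alphabet V)"

locale G_automaton = group G for G (structure) +
  fixes V :: "('q, 's, 'a) automaton"
  assumes finite_states: "finite (states V)"
    and finite_alphabet: "finite (input_alphabet V)"
    and initial_state: "initial V \<in> states V"
    and accepting_states: "accepting V \<subseteq> states V"
    and finite_delta: "q \<in> states V \<Longrightarrow> s \<in> labels V \<Longrightarrow> finite (delta V q s)"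
    and delta_closed: "q \<in> states V \<Longrightarrow> s \<in> labels V \<Longrightarrow>
      delta V q s \<subseteq> states V \<times> carrier G"

text \<open>A configuration consists of the state, the unread input and the register content.\<close>

inductive step ::
  "('a, 'b) monoid_scheme \<Rightarrow> ('q, 's, 'a) automaton \<Rightarrow>
    'q \<times> 's list \<times> 'a \<Rightarrow> 'q \<times> 's list \<times> 'a \<Rightarrow> bool"
  for G (structure) and V where
  epsilon: "(q', m) \<in> delta V q None \<Longrightarrow> step G V (q, w, x) (q', w, x \<otimes> m)"
| letter: "(q', m) \<in> delta V q (Some a) \<Longrightarrow> step G V (q, a # w, x) (q', w, x \<otimes> m)"

definition language ::
  "('a, 'b) monoid_scheme \<Rightarrow> ('q, 's, 'a) automaton \<Rightarrow> 's list set" where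
  "language G V = {w \<in> lists (input_alphabet V). \<exists>q \<in> accepting V.
    (step G V)\<^sup>*\<^sup>* (initial V, w, \<one>\<^bsub>G\<^esub>) (q, [], \<one>\<^bsub>G\<^esub>)}"


section \<open>Codes of group elements and of automata\<close>

text \<open>An encoding of the elements of \<open>G\<close> by finite strings over the alphabet \<open>{..<k}\<close>, given by
  its decoding function: \<open>dec w = Some g\<close> means that \<open>w\<close> is a code of \<open>g\<close>. Every element has at
  least one code; no effectiveness is assumed, neither of the set of codes nor of the
  multiplication.\<close>

definition element_encoding ::
  "('a, 'b) monoid_scheme \<Rightarrow> nat \<Rightarrow> (nat list \<rightharpoonup> 'a) \<Rightarrow> bool" where
  "element_encoding G k dec \<longleftrightarrow> dom dec \<subseteq> lists {..<k} \<and> ran dec = carrier G"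

definition codes_element :: "(nat list \<rightharpoonup> 'a) \<Rightarrow> nat \<Rightarrow> 'a \<Rightarrow> bool" where
  "codes_element dec x g \<longleftrightarrow> (\<exists>w. x = list_encode w \<and> dec w = Some g)"

fun transition_encode :: "nat \<times> nat option \<times> nat \<times> nat list \<Rightarrow> nat" where
  "transition_encode (q, s, q', w) =
    prod_encode (q, prod_encode (case s of None \<Rightarrow> 0 | Some a \<Rightarrow> Suc a,
      prod_encode (q', list_encode w)))"

text \<open>For automata to serve as inputs of an algorithm, states and letters have to be named by
  finite data; here they are natural numbers. The code lists the states, the letters, the
  transitions \<open>(q, s, q', w)\<close> with \<open>w\<close> a code of the group element, the initial state and the
  accepting states, in any order and possibly with repetitions.\<close>

definition codes_automaton ::
  "('a, 'b) monoid_scheme \<Rightarrow> (nat list \<rightharpoonup> 'a) \<Rightarrow> nat \<Rightarrow> (nat, nat, 'a) automaton \<Rightarrow> bool" where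
  "codes_automaton G dec x V \<longleftrightarrow> G_automaton G V \<and>
    (\<exists>Qs As Ts Fs.
      x = prod_encode (list_encode Qs, prod_encode (list_encode As,
        prod_encode (list_encode (map transition_encode Ts),
          prod_encode (initial V, list_encode Fs)))) \<and>
      set Qs = states V \<and> set As = input_alphabet V \<and> set Fs = accepting V \<and>
      (\<forall>(q, s, q', w) \<in> set Ts. w \<in> dom dec) \<and>
      (\<lambda>(q, s, q', w). (q, s, q', the (dec w))) ` set Ts =
        {(q, s, q', m). q \<in> states V \<and> s \<in> labels V \<and> (q', m) \<in> delta V q s})"

lemma ex_codes_automaton:
  assumes enc: "element_encoding G k dec" and V: "G_automaton G V"
  shows "\<exists>x. codes_automaton G dec x V"
proof -
  interpret G_automaton G V by (rule V)
  let ?T = "{(q, s, q', m). q \<in> states V \<and> s \<in> labels V \<and> (q', m) \<in> delta V q s}"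
  have "finite (SIGMA q : states V. SIGMA s : labels V. delta V q s)"
    using finite_states finite_alphabet finite_delta
    by (intro finite_SigmaI) (auto simp: labels_def)
  moreover have "?T = (SIGMA q : states V. SIGMA s : labels V. delta V q s)" by auto
  ultimately have "finite ?T" by simp
  then obtain ts where ts: "set ts = ?T" using finite_list by blast
  have "finite (accepting V)" using finite_states accepting_states finite_subset by blast
  then obtain Qs As Fs where
    l: "set Qs = states V" "set As = input_alphabet V" "set Fs = accepting V"
    using finite_states finite_alphabet finite_list by metis
  define c where "c g = (SOME w. dec w = Some g)" for g
  have c: "dec (c m) = Some m" if "(q, s, q', m) \<in> ?T" for q s q' m
  proof -
    have "m \<in> ran dec" using that delta_closed enc by (fastforce simp: element_encoding_def)
    then show ?thesis unfolding c_def ran_def by (auto intro: someI)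
  qed
  define Ts where "Ts = map (\<lambda>(q, s, q', m). (q, s, q', c m)) ts"
  have "\<forall>(q, s, q', w) \<in> set Ts. w \<in> dom dec"
    using c by (fastforce simp: Ts_def ts)
  moreover have "(\<lambda>(q, s, q', w). (q, s, q', the (dec w))) ` set Ts = (\<lambda>t. t) ` ?T"
    unfolding Ts_def set_map ts image_image by (rule image_cong) (use c in auto)
  ultimately have "codes_automaton G dec
    (prod_encode (list_encode Qs, prod_encode (list_encode As,
      prod_encode (list_encode (map transition_encode Ts),
        prod_encode (initial V, list_encode Fs))))) V"
    using V l unfolding codes_automaton_def image_ident
    by (intro conjI exI[of _ Qs] exI[of _ As] exI[of _ Ts] exI[of _ Fs]) (rule refl | assumption)+
  then show ?thesis ..
qed


section \<open>The two decision problems\<close>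

definition finitely_generated_subgroup :: "('a, 'b) monoid_scheme \<Rightarrow> 'a set \<Rightarrow> bool" where
  "finitely_generated_subgroup G H \<longleftrightarrow>
    (\<exists>S. finite S \<and> S \<subseteq> carrier G \<and> H = generate G S)"

definition universe_problem_decidable ::
  "('a, 'b) monoid_scheme \<Rightarrow> (nat list \<rightharpoonup> 'a) \<Rightarrow> bool" where
  "universe_problem_decidable G dec \<longleftrightarrow>
    decidable (codes_automaton G dec) (\<lambda>V. language G V = lists (input_alphabet V))"

definition membership_problem_decidable :: "(nat list \<rightharpoonup> 'a) \<Rightarrow> 'a set \<Rightarrow> bool" where
  "membership_problem_decidable dec H \<longleftrightarrow> decidable (codes_element dec) (\<lambda>g. g \<in> H)"

end

theory Submission
  imports Defs
begin

text \<open>Given \<open>g\<close>, take the automaton with states 0 and 1 that in state 0 multiplies its register by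
  generators of \<open>H\<close> and their inverses, moves to the accepting state 1 by multiplying with \<open>g\<close>,
  and only there reads its input, leaving the register alone. It accepts any given word iff
  \<open>h \<otimes> g = \<one>\<close> for some \<open>h \<in> H\<close>, that is, iff \<open>g \<in> H\<close>. A code of the automaton is computed from
  a code of \<open>g\<close> by pairing with constants.\<close>

section \<open>Recursive functions for constants, pairs and list codes\<close>

lemma computes_Comp1:
  assumes "computes g xs z" "computes f [z] y"
  shows "computes (Comp f [g]) xs y"
  using assms by (intro computes.Comp[where zs = "[z]"]) auto

lemma computes_Comp2:
  assumes "computes g xs z" "computes h xs z'" "computes f [z, z'] y"
  shows "computes (Comp f [g, h]) xs y"
  using assms by (intro computes.Comp[where zs = "[z, z']"]) auto

fun recf_const :: "nat \<Rightarrow> recf" where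
  "recf_const 0 = Zero"
| "recf_const (Suc n) = Comp Succ [recf_const n]"

lemma computes_const: "computes (recf_const n) xs n"
  by (induction n) (simp_all add: computes.Zero computes_Comp1[OF _ computes.Succ])

definition recf_add :: recf where
  "recf_add = PrimRec (Proj 0) (Comp Succ [Proj 1])"

lemma computes_add: "computes recf_add [m, n] (m + n)"
proof (induction m)
  case 0
  show ?case
    using computes.PrimRec_0[OF computes.Proj[of 0 "[n]"]] by (simp add: recf_add_def)
next
  case (Suc m)
  have "computes (Comp Succ [Proj 1]) [m, m + n, n] (Suc (m + n))"
    using computes_Comp1[OF computes.Proj[of 1 "[m, m + n, n]"] computes.Succ] by simp
  then show ?case
    using computes.PrimRec_Suc Suc.IH unfolding recf_add_def add_Suc by blast
qed

text \<open>Follows \<open>triangle (Suc n) = triangle n + Suc n\<close>; in the step function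
  \<open>Proj 0\<close> is \<open>n\<close> and \<open>Proj 1\<close> the previous value.\<close>

definition recf_triangle :: recf where
  "recf_triangle = PrimRec Zero (Comp Succ [Comp recf_add [Proj 1, Proj 0]])"

lemma computes_triangle: "computes recf_triangle [n] (triangle n)"
proof (induction n)
  case 0
  show ?case
    by (simp add: recf_triangle_def computes.PrimRec_0 computes.Zero)
next
  case (Suc n)
  have "computes (Comp Succ [Comp recf_add [Proj 1, Proj 0]]) [n, triangle n]
      (triangle (Suc n))"
    using computes_Comp1[OF computes_Comp2[OF computes.Proj[of 1 "[n, triangle n]"]
      computes.Proj[of 0 "[n, triangle n]"] computes_add] computes.Succ] by simp
  then show ?case
    using computes.PrimRec_Suc Suc.IH unfolding recf_triangle_def by blast
qed

text \<open>Cantor pairing: \<open>prod_encode (y, z)\<close> is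
  \<open>triangle (y + z) + y\<close>.\<close>

definition recf_pair :: "recf \<Rightarrow> recf \<Rightarrow> recf" where
  "recf_pair f g = Comp recf_add [Comp recf_triangle [Comp recf_add [f, g]], f]"

lemma computes_pair:
  assumes "computes f xs y" "computes g xs z"
  shows "computes (recf_pair f g) xs (prod_encode (y, z))"
  unfolding recf_pair_def prod_encode_def prod.case
  by (rule computes_Comp2[OF computes_Comp1[OF computes_Comp2[OF assms computes_add]
    computes_triangle] assms(1) computes_add])

text \<open>A nonempty list is coded by the successor of the pair of its head and the code of its
  tail. This serves to put one transition that depends on the input in front of a constant
  list.\<close>

lemma computes_list_encode_Cons:
  assumes "computes f xs y" "computes g xs (list_encode ys)"
  shows "computes (Comp Succ [recf_pair f g]) xs (list_encode (y # ys))"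
  using computes_Comp1[OF computes_pair[OF assms] computes.Succ] by simp


section \<open>The automaton and its language\<close>

definition coset_automaton ::
  "('a, 'b) monoid_scheme \<Rightarrow> 'a set \<Rightarrow> 'a \<Rightarrow> (nat, nat, 'a) automaton" where
  "coset_automaton G T g =
    \<lparr>states = {0, 1}, input_alphabet = {0},
     delta = (\<lambda>q s. if q = 0 \<and> s = None then insert (1, g) (Pair 0 ` T)
       else if q = 1 \<and> s = Some 0 then {(1, \<one>\<^bsub>G\<^esub>)} else {}),
     initial = 0, accepting = {1}\<rparr>"

context group
begin

lemma G_automaton_coset_automaton:
  assumes "finite T" "T \<subseteq> carrier G" "g \<in> carrier G"
  shows "G_automaton G (coset_automaton G T g)"
  using assms by unfold_locales (auto simp: coset_automaton_def labels_def split: if_splits)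

text \<open>An invariant of runs: the loops at state 0 multiply by elements of \<open>H\<close>, the
  move to state 1 carries \<open>H\<close> to the coset \<open>H #> g\<close>, and the loop at state
  1 multiplies by \<open>\<one>\<close>.\<close>

lemma reachable_coset_automaton:
  assumes "(step G (coset_automaton G T g))\<^sup>*\<^sup>* (0, w, \<one>) (q, v, x)"
    and T: "T \<subseteq> H" and H: "subgroup H G" and g: "g \<in> carrier G"
  shows "q = 0 \<and> x \<in> H \<or> q = 1 \<and> x \<in> H #> g"
  using assms(1)
proof (induction "(q, v, x)" arbitrary: q v x rule: rtranclp_induct)
  case base
  then show ?case using H by (simp add: subgroup.one_closed)
next
  case (step c)
  obtain p u y where c: "c = (p, u, y)" by (cases c)
  have "H #> g \<subseteq> carrier G"
    using H g by (simp add: r_coset_subset_G subgroup.subset)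
  then have one: "y \<otimes> \<one> = y" if "y \<in> H #> g"
    using that by auto
  have IH: "p = 0 \<and> y \<in> H \<or> p = 1 \<and> y \<in> H #> g"
    using step.hyps(3) c by blast
  from step.hyps(2) c have "step G (coset_automaton G T g) (p, u, y) (q, v, x)" by simp
  then show ?case
  proof cases
    case (epsilon m)
    then show ?thesis
      using IH T subgroup.m_closed[OF H]
      by (auto simp: coset_automaton_def r_coset_def split: if_splits)
  next
    case (letter m a)
    then show ?thesis
      using IH one by (auto simp: coset_automaton_def split: if_splits)
  qed
qed

text \<open>Generators and inverses of generators are single loops at state 0, and products are
  concatenated runs. The starting content \<open>y\<close> is arbitrary because the run for the
  second factor starts where the first one ends.\<close>

lemma coset_automaton_generate:
  assumes "x \<in> generate G S" "S \<subseteq> carrier G" "y \<in> carrier G"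
  shows "(step G (coset_automaton G (S \<union> m_inv G ` S) g))\<^sup>*\<^sup>* (0, w, y) (0, w, y \<otimes> x)"
  using assms(1,3)
proof (induction arbitrary: y rule: generate.induct)
  case one
  then show ?case by simp
next
  case (incl h)
  then show ?case
    by (intro r_into_rtranclp step.epsilon) (simp add: coset_automaton_def)
next
  case (inv h)
  then show ?case
    by (intro r_into_rtranclp step.epsilon) (simp add: coset_automaton_def)
next
  case (eng h1 h2)
  have h: "h1 \<in> carrier G" "h2 \<in> carrier G"
    using eng.hyps generate_in_carrier[OF assms(2)] by auto
  then show ?case
    using rtranclp_trans[OF eng.IH(1)[of y] eng.IH(2)[of "y \<otimes> h1"]] eng.prems
    by (simp add: m_assoc)
qed

lemma coset_automaton_read:
  assumes "w \<in> lists {0}"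
  shows "(step G (coset_automaton G T g))\<^sup>*\<^sup>* (1, w, \<one>) (1, [], \<one>)"
  using assms
proof (induction w)
  case Nil
  show ?case by simp
next
  case (Cons a w)
  then have "step G (coset_automaton G T g) (1, a # w, \<one>) (1, w, \<one> \<otimes> \<one>)"
    by (intro step.letter) (simp add: coset_automaton_def)
  then show ?case using Cons by (simp add: converse_rtranclp_into_rtranclp)
qed

lemma coset_automaton_universal_iff:
  assumes S: "S \<subseteq> carrier G" and g: "g \<in> carrier G"
  defines "V \<equiv> coset_automaton G (S \<union> m_inv G ` S) g"
  shows "language G V = lists (input_alphabet V) \<longleftrightarrow> g \<in> generate G S"
proof
  have H: "subgroup (generate G S) G" by (rule generate_is_subgroup[OF S])
  assume "language G V = lists (input_alphabet V)"
  \<comment> \<open>A single accepted word already forces \<open>g\<close> into the subgroup; the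
    empty word will do.\<close>
  then have "[] \<in> language G V" by simp
  then have "(step G V)\<^sup>*\<^sup>* (0, [], \<one>) (1, [], \<one>)"
    by (simp add: language_def V_def coset_automaton_def)
  moreover have "S \<union> m_inv G ` S \<subseteq> generate G S"
    by (auto intro: generate.incl generate.inv)
  ultimately have "\<one> \<in> generate G S #> g"
    using reachable_coset_automaton[OF _ _ H g] unfolding V_def by fastforce
  then obtain h where h: "h \<in> generate G S" "h \<otimes> g = \<one>"
    by (auto simp: r_coset_def)
  then have "inv h = g"
    using g subgroup.mem_carrier[OF H] by (metis inv_equality inv_inv)
  then show "g \<in> generate G S"
    using h(1) subgroup.m_inv_closed[OF H] by blast
next
  assume "g \<in> generate G S"
  \<comment> \<open>The content to reach in state 0, so that the move labelled \<open>g\<close>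
    restores \<open>\<one>\<close>.\<close>
  then have g': "inv g \<in> generate G S"
    by (rule subgroup.m_inv_closed[OF generate_is_subgroup[OF S]])
  have "w \<in> language G V" if w: "w \<in> lists {0}" for w
  proof -
    have "(step G V)\<^sup>*\<^sup>* (0, w, \<one>) (0, w, inv g)"
      using coset_automaton_generate[OF g' S one_closed] g by (simp add: V_def)
    also have "step G V (0, w, inv g) (1, w, inv g \<otimes> g)"
      by (intro step.epsilon) (simp add: V_def coset_automaton_def)
    also have "inv g \<otimes> g = \<one>" using g by simp
    also have "(step G V)\<^sup>*\<^sup>* (1, w, \<one>) (1, [], \<one>)"
      unfolding V_def by (rule coset_automaton_read[OF w])
    finally show ?thesis
      using w by (simp add: language_def V_def coset_automaton_def)
  qed
  then show "language G V = lists (input_alphabet V)"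
    by (auto simp: language_def V_def coset_automaton_def)
qed

section \<open>Computing a code of the automaton\<close>

text \<open>Only one transition depends on \<open>g\<close>, and its label can be given by the very
  code that was received. Codes of the finitely many other labels are chosen once and built into the
  program as constants, so no arithmetic in the group has to be effective.\<close>

lemma codes_coset_automaton_computable:
  assumes enc: "element_encoding G k dec" and T: "finite T" "T \<subseteq> carrier G"
  shows "\<exists>f. \<forall>x g. codes_element dec x g \<longrightarrow>
    (\<exists>y. computes f [x] y \<and> codes_automaton G dec y (coset_automaton G T g))"
proof -
  have "\<exists>w. dec w = Some m" if "m \<in> carrier G" for m
    using that enc by (auto simp: element_encoding_def ran_def)
  then obtain c where c: "dec (c m) = Some m" if "m \<in> carrier G" for m
    by metis
  obtain ts where ts: "set ts = T" using T finite_list by blast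
  \<comment> \<open>The transitions that are the same for all \<open>g\<close>.\<close>
  define Cs :: "(nat \<times> nat option \<times> nat \<times> nat list) list"
    where "Cs = (1, Some 0, 1, c \<one>) # map (\<lambda>m. (0, None, 0, c m)) ts"
  \<comment> \<open>The inner constants 0, 0, 1 are the source state, the code of
    \<open>None\<close> and the target state of the move labelled \<open>g\<close>;
    \<open>Proj 0\<close> copies the input \<open>x\<close> as the code of its label.\<close>
  define f where "f =
    recf_pair (recf_const (list_encode [0, 1])) (recf_pair (recf_const (list_encode [0]))
      (recf_pair
        (Comp Succ [recf_pair
          (recf_pair (recf_const 0) (recf_pair (recf_const 0) (recf_pair (recf_const 1) (Proj 0))))
          (recf_const (list_encode (map transition_encode Cs)))])
        (recf_const (prod_encode (0, list_encode [1])))))"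
  have "\<exists>y. computes f [x] y \<and> codes_automaton G dec y (coset_automaton G T g)"
    if x: "codes_element dec x g" for x g
  proof -
    let ?V = "coset_automaton G T g"
    obtain w where w: "x = list_encode w" "dec w = Some g"
      using x by (auto simp: codes_element_def)
    then have g: "g \<in> carrier G" using enc by (auto simp: element_encoding_def ran_def)
    let ?Ts = "(0, None, 1, w) # Cs"
    let ?y = "prod_encode (list_encode [0, 1], prod_encode (list_encode [0],
      prod_encode (list_encode (map transition_encode ?Ts), prod_encode (0, list_encode [1]))))"
    have "computes (Proj 0) [x] (list_encode w)"
      using computes.Proj[of 0 "[x]"] w by simp
    then have "computes (recf_pair (recf_const 0)
        (recf_pair (recf_const 0) (recf_pair (recf_const 1) (Proj 0)))) [x]
        (transition_encode (0, None, 1, w))"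
      unfolding transition_encode.simps option.case by (intro computes_pair computes_const)
    then have "computes f [x] ?y"
      unfolding f_def list.map
      by (intro computes_pair computes_list_encode_Cons computes_const)
    moreover have "codes_automaton G dec ?y ?V"
    proof -
      have "\<forall>(q, s, q', w) \<in> set ?Ts. w \<in> dom dec"
        using w c T ts by (auto simp: Cs_def)
      moreover have "(\<lambda>(q, s, q', w). (q, s, q', the (dec w))) ` set ?Ts =
          {(q, s, q', m). q \<in> states ?V \<and> s \<in> labels ?V \<and> (q', m) \<in> delta ?V q s}"
      proof -
        have "(\<lambda>(q, s, q', w). (q, s, q', the (dec w))) ` set ?Ts =
            insert (0, None, 1, g) (insert (1, Some 0, 1, \<one>) ((\<lambda>m. (0, None, 0, m)) ` T))"
          using w c T by (simp add: Cs_def ts image_image subset_iff)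
        also have "\<dots> =
            {(q, s, q', m). q \<in> states ?V \<and> s \<in> labels ?V \<and> (q', m) \<in> delta ?V q s}"
          by (auto simp: coset_automaton_def labels_def split: if_splits)
        finally show ?thesis .
      qed
      moreover have "?y = prod_encode (list_encode [0, 1], prod_encode (list_encode [0],
          prod_encode (list_encode (map transition_encode ?Ts),
            prod_encode (initial ?V, list_encode [1]))))"
        "set [0, 1] = states ?V" "set [0] = input_alphabet ?V" "set [1] = accepting ?V"
        by (simp_all add: coset_automaton_def del: list_encode.simps)
      ultimately show ?thesis
        using G_automaton_coset_automaton[OF T g] unfolding codes_automaton_def
        by - (rule conjI, assumption, rule exI[of _ "[0, 1]"], rule exI[of _ "[0]"],
          rule exI[of _ ?Ts], rule exI[of _ "[1]"], intro conjI)
    qed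
    ultimately show ?thesis by blast
  qed
  then show ?thesis by blast
qed

end

section \<open>Reduction of membership to universality\<close>

theorem theorem9:
  fixes G :: "('a, 'b) monoid_scheme" and H :: "'a set"
    and k :: nat and dec :: "nat list \<rightharpoonup> 'a"
  assumes "group G"
    and "element_encoding G k dec"
    and "finitely_generated_subgroup G H"
    and "universe_problem_decidable G dec"
  shows "membership_problem_decidable dec H"
proof -
  interpret group G by fact
  obtain S where S: "finite S" "S \<subseteq> carrier G" and H: "H = generate G S"
    using assms(3) by (auto simp: finitely_generated_subgroup_def)
  let ?V = "coset_automaton G (S \<union> m_inv G ` S)"
  obtain u where u: "codes_automaton G dec y V \<Longrightarrow>
      computes u [y] (if language G V = lists (input_alphabet V) then 1 else 0)" for y V
    using assms(4) by (auto simp: universe_problem_decidable_def decidable_def)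
  have "finite (S \<union> m_inv G ` S)" "S \<union> m_inv G ` S \<subseteq> carrier G"
    using S by auto
  from codes_coset_automaton_computable[OF assms(2) this]
  obtain f where f: "\<forall>x g. codes_element dec x g \<longrightarrow>
      (\<exists>y. computes f [x] y \<and> codes_automaton G dec y (?V g))"
    by blast
  \<comment> \<open>Different codes of \<open>g\<close> may lead \<open>f\<close> to different codes
    of the same automaton; this is harmless, since \<open>u\<close> answers correctly on each of
    them.\<close>
  have "computes (Comp u [f]) [x] (if g \<in> H then 1 else 0)" if x: "codes_element dec x g" for x g
  proof -
    have "g \<in> carrier G"
      using x assms(2) by (auto simp: codes_element_def element_encoding_def ran_def)
    then have "language G (?V g) = lists (input_alphabet (?V g)) \<longleftrightarrow> g \<in> H"
      unfolding H by (rule coset_automaton_universal_iff[OF S(2)])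
    moreover obtain y where "computes f [x] y" "codes_automaton G dec y (?V g)"
      using f x by blast
    ultimately show ?thesis
      using computes_Comp1[OF _ u[of y "?V g"]] by simp
  qed
  then show ?thesis
    unfolding membership_problem_decidable_def decidable_def by blast
qed

end
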